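(* Let $S$ be a commutative unital semiring with zero containing an element of infinite multiplicative order, and let $n$ be a positive integer. The sylvester monoid $\mathrm{sylv}_n$ of rank $n$ admits a faithful representation by upper triangular matrices of size $n^2$ over $S$ (that is, an injective monoid homomorphism $\mathrm{sylv}_n\to\mathrm{UT}_{n^2}(S)$) having block-diagonal structure with largest block of size $2$ (or size $1$ if $n=1$).
   Context: $[n]=\{1,\dots,n\}$, and $[n]^*$ is the free monoid on $[n]$. $\mathrm{UT}_m(S)$ is the monoid of $m\times m$ upper triangular matrices over the semiring $S$ (entries below the diagonal equal to $0_S$) under matrix multiplication. A right strict binary search tree is a (possibly empty) rooted binary tree, with children designated left and right, whose vertices are labelled by positive integers, such that the label of each vertex is greater than or equal to every label in its left subtree and strictly less than every label in its right subtree. Insertion of a symbol $a$ into such a tree $T$: if $T$ is empty, create a vertex labelled $a$; otherwise let $x$ be the label of the root; if $a\le x$ recursively insert $a$ into the left subtree of the root, otherwise recursively insert $a$ into the right subtree. For a word $u$ over the positive integers, $\mathrm{P}_{\mathrm{sylv}}(u)$ is the tree obtained from the empty tree by inserting the symbols of $u$ from right to left. The relation $u\equiv_{\mathrm{sylv}}v\iff\mathrm{P}_{\mathrm{sylv}}(u)=\mathrm{P}_{\mathrm{sylv}}(v)$ is a congruence, and $\mathrm{sylv}_n=[n]^*/{\equiv_{\mathrm{sylv}}}$. *)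

theory Defs
  imports "Jordan_Normal_Form.Matrix" "HOL-Library.Tree" "HOL-Algebra.Group"
begin

section \<open>The sylvester monoid\<close>

fun right_strict_bst :: "nat tree \<Rightarrow> bool" where
  "right_strict_bst Leaf = True"
| "right_strict_bst (Node l x r) =
    (right_strict_bst l \<and> right_strict_bst r \<and>
     (\<forall>y\<in>set_tree l. y \<le> x) \<and> (\<forall>y\<in>set_tree r. x < y))"

fun bst_insert :: "nat \<Rightarrow> nat tree \<Rightarrow> nat tree" where
  "bst_insert a Leaf = Node Leaf a Leaf"
| "bst_insert a (Node l x r) =
    (if a \<le> x then Node (bst_insert a l) x r else Node l x (bst_insert a r))"

text \<open>\<open>foldr\<close> consumes the word from its right end, as the insertion order requires.\<close>

definition P_sylv :: "nat list \<Rightarrow> nat tree" where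
  "P_sylv u = foldr bst_insert u Leaf"

definition sylv_rel :: "nat \<Rightarrow> (nat list \<times> nat list) set" where
  "sylv_rel n = {(u, v). u \<in> lists {1..n} \<and> v \<in> lists {1..n} \<and> P_sylv u = P_sylv v}"

text \<open>The product of two classes is the union of the classes of \<open>u @ v\<close> over all
  representatives; it is a single class by \<open>sylv_rel_append\<close> below
  (cf. \<open>mult_sylv_classes\<close>).\<close>

definition sylv :: "nat \<Rightarrow> nat list set monoid" where
  "sylv n = \<lparr>carrier = lists {1..n} // sylv_rel n,
             mult = (\<lambda>A B. \<Union>u\<in>A. \<Union>v\<in>B. sylv_rel n `` {u @ v}),
             one = sylv_rel n `` {[]}\<rparr>"

lemma set_tree_bst_insert: "set_tree (bst_insert a T) = insert a (set_tree T)"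
  by (induction T) auto

lemma right_strict_bst_insert: "right_strict_bst T \<Longrightarrow> right_strict_bst (bst_insert a T)"
  by (induction T) (auto simp: set_tree_bst_insert)

lemma right_strict_bst_P_sylv: "right_strict_bst (P_sylv u)"
  unfolding P_sylv_def by (induction u) (auto simp: right_strict_bst_insert)

fun restrict_le :: "nat \<Rightarrow> nat tree \<Rightarrow> nat tree" where
  "restrict_le a Leaf = Leaf"
| "restrict_le a (Node l x r) =
    (if x \<le> a then Node l x (restrict_le a r) else restrict_le a l)"

fun restrict_gt :: "nat \<Rightarrow> nat tree \<Rightarrow> nat tree" where
  "restrict_gt a Leaf = Leaf"
| "restrict_gt a (Node l x r) =
    (if x > a then Node (restrict_gt a l) x r else restrict_gt a r)"

lemma restrict_le_insert:
  "restrict_le a (bst_insert b T) =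
    (if b \<le> a then bst_insert b (restrict_le a T) else restrict_le a T)"
  by (induction T) auto

lemma restrict_gt_insert:
  "restrict_gt a (bst_insert b T) =
    (if b > a then bst_insert b (restrict_gt a T) else restrict_gt a T)"
  by (induction T) auto

lemma P_sylv_filter_le: "P_sylv (filter (\<lambda>b. b \<le> a) u) = restrict_le a (P_sylv u)"
  unfolding P_sylv_def by (induction u) (auto simp: restrict_le_insert)

lemma P_sylv_filter_gt: "P_sylv (filter (\<lambda>b. b > a) u) = restrict_gt a (P_sylv u)"
  unfolding P_sylv_def by (induction u) (auto simp: restrict_gt_insert)

lemma foldr_insert_Node:
  "foldr bst_insert u (Node l x r) =
    Node (foldr bst_insert (filter (\<lambda>b. b \<le> x) u) l) x
         (foldr bst_insert (filter (\<lambda>b. b > x) u) r)"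
  by (induction u) auto

lemma foldr_insert_cong:
  "P_sylv u = P_sylv v \<Longrightarrow> foldr bst_insert u T = foldr bst_insert v T"
proof (induction T arbitrary: u v)
  case Leaf
  then show ?case by (simp add: P_sylv_def)
next
  case (Node l x r)
  then show ?case
    by (simp add: foldr_insert_Node P_sylv_filter_le P_sylv_filter_gt)
qed

lemma P_sylv_append_cong:
  "P_sylv u = P_sylv u' \<Longrightarrow> P_sylv v = P_sylv v' \<Longrightarrow> P_sylv (u @ v) = P_sylv (u' @ v')"
  using foldr_insert_cong[of u u' "P_sylv v'"] by (simp add: P_sylv_def)

lemma equiv_sylv_rel: "equiv (lists {1..n}) (sylv_rel n)"
  by (rule equivI) (auto simp: sylv_rel_def refl_on_def sym_def trans_def)

lemma sylv_rel_append:
  "(u, u') \<in> sylv_rel n \<Longrightarrow> (v, v') \<in> sylv_rel n \<Longrightarrow> (u @ v, u' @ v') \<in> sylv_rel n"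
  by (auto simp: sylv_rel_def intro: P_sylv_append_cong)

lemma mult_sylv_classes:
  assumes "u \<in> lists {1..n}" "v \<in> lists {1..n}"
  shows "(sylv_rel n `` {u}) \<otimes>\<^bsub>sylv n\<^esub> (sylv_rel n `` {v}) = sylv_rel n `` {u @ v}"
proof -
  have "congruent2 (sylv_rel n) (sylv_rel n) (\<lambda>u v. sylv_rel n `` {u @ v})"
    by (intro congruent2I') (metis equiv_class_eq equiv_sylv_rel sylv_rel_append)
  from UN_equiv_class2[OF equiv_sylv_rel equiv_sylv_rel this assms] show ?thesis
    by (simp add: sylv_def)
qed

lemma monoid_sylv: "Group.monoid (sylv n)"
proof (rule monoidI)
  have carr: "\<exists>u\<in>lists {1..n}. x = sylv_rel n `` {u}" if "x \<in> carrier (sylv n)" for x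
    using that by (auto simp: sylv_def elim!: quotientE)
  have cls: "sylv_rel n `` {u} \<in> carrier (sylv n)" if "u \<in> lists {1..n}" for u
    using that by (auto simp: sylv_def intro: quotientI)
  have one: "\<one>\<^bsub>sylv n\<^esub> = sylv_rel n `` {[]}" by (simp add: sylv_def)
  have app: "u @ v \<in> lists {1..n}" if "u \<in> lists {1..n}" "v \<in> lists {1..n}" for u v
    using that by auto
  show "\<one>\<^bsub>sylv n\<^esub> \<in> carrier (sylv n)"
    unfolding one by (rule cls) simp
  fix x y z
  assume x: "x \<in> carrier (sylv n)"
  obtain u where u: "u \<in> lists {1..n}" "x = sylv_rel n `` {u}" using carr[OF x] by blast
  show "\<one>\<^bsub>sylv n\<^esub> \<otimes>\<^bsub>sylv n\<^esub> x = x"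
    using mult_sylv_classes[of "[]" n u] u one by simp
  show "x \<otimes>\<^bsub>sylv n\<^esub> \<one>\<^bsub>sylv n\<^esub> = x"
    using mult_sylv_classes[of u n "[]"] u one by simp
  assume y: "y \<in> carrier (sylv n)"
  obtain v where v: "v \<in> lists {1..n}" "y = sylv_rel n `` {v}" using carr[OF y] by blast
  show "x \<otimes>\<^bsub>sylv n\<^esub> y \<in> carrier (sylv n)"
    unfolding u(2) v(2) mult_sylv_classes[OF u(1) v(1)] by (intro cls app u v)
  assume z: "z \<in> carrier (sylv n)"
  obtain w where w: "w \<in> lists {1..n}" "z = sylv_rel n `` {w}" using carr[OF z] by blast
  show "x \<otimes>\<^bsub>sylv n\<^esub> y \<otimes>\<^bsub>sylv n\<^esub> z = x \<otimes>\<^bsub>sylv n\<^esub> (y \<otimes>\<^bsub>sylv n\<^esub> z)"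
    unfolding u(2) v(2) w(2)
    by (simp only: mult_sylv_classes u(1) v(1) w(1) app append_assoc)
qed

section \<open>Upper triangular matrices over a semiring\<close>

definition UT :: "'a::comm_semiring_1 itself \<Rightarrow> nat \<Rightarrow> 'a mat monoid" where
  "UT ty m = \<lparr>carrier = {A \<in> carrier_mat m m. upper_triangular A}, mult = (*), one = 1\<^sub>m m\<rparr>"

lemma upper_triangular_mult:
  fixes A B :: "'a::comm_semiring_1 mat"
  assumes A: "A \<in> carrier_mat m m" "upper_triangular A"
    and B: "B \<in> carrier_mat m m" "upper_triangular B"
  shows "upper_triangular (A * B)"
proof (rule upper_triangularI)
  fix i j assume ji: "j < i" and i: "i < dim_row (A * B)"
  have "A $$ (i, k) * B $$ (k, j) = 0" if "k < m" for k
  proof (cases "k < i")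
    case True
    then show ?thesis using A i by (simp add: upper_triangularD)
  next
    case False
    then show ?thesis using B ji that by (simp add: upper_triangularD)
  qed
  then show "(A * B) $$ (i, j) = 0"
    using A(1) B(1) ji i by (simp add: scalar_prod_def)
qed

lemma monoid_UT: "Group.monoid (UT TYPE('a::comm_semiring_1) m)"
  by (rule monoidI) (auto simp: UT_def intro: upper_triangular_mult)

definition infinite_mult_order :: "'a::comm_semiring_1 \<Rightarrow> bool" where
  "infinite_mult_order s \<longleftrightarrow> inj (\<lambda>k::nat. s ^ k)"

text \<open>\<open>ds\<close> lists the sizes of the square diagonal blocks, from top left to bottom right.\<close>

definition block_diagonal :: "nat list \<Rightarrow> 'a::zero mat \<Rightarrow> bool" where
  "block_diagonal ds A \<longleftrightarrow>
    (\<exists>Bs. list_all2 (\<lambda>B d. B \<in> carrier_mat d d) Bs ds \<and> A = diag_block_mat Bs)"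

end

theory Submission
  imports Defs
begin

text \<open>
  Fix a word \<open>u\<close> and letters \<open>i \<le> j\<close>, and read \<open>u\<close> from right to left, as insertion does. Let
  \<open>run i j u\<close> be the number of letters \<open>j\<close> met before the first letter of \<open>{i..<j}\<close>. These numbers
  are a complete set of invariants of the sylvester congruence (\<open>P_sylv_eq_iff_runs\<close>). The reason
  is the recursive shape of the tree: the last letter \<open>x\<close> of a word is the root, and its left and
  right subtrees are the trees of the remaining letters \<open>\<le> x\<close> and \<open>> x\<close> (\<open>P_sylv_snoc\<close>). The runs
  see the same three pieces of data. Two words with different last letters \<open>x < y\<close> are told apart by
  \<open>run x y\<close>, which vanishes on the first and not on the second; and once the last letters agree,
  the runs of the two words agree iff those of both pairs of subwords do (\<open>runs_snoc_iff\<close>).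

  Each run is computed by a two-state device: reading further letters to the left, one keeps
  counting until a separating letter occurs, and then the count is frozen. With \<open>s\<close> of infinite
  order, let the letter \<open>j\<close> act as \<open>D = diag(1, s)\<close>, each letter of \<open>{i..<j}\<close> as the idempotent
  \<open>E\<close> with rows \<open>(1, 1)\<close> and \<open>(0, 0)\<close>, and all other letters as the identity. Since \<open>D E = E\<close>, a
  word acts as \<open>D\<^sup>r\<close> or as \<open>E D\<^sup>r\<close>, where \<open>r\<close> is its run, according to whether it lacks or contains
  a separating letter. For \<open>i = j\<close> there are no separating letters and the \<open>1 \<times> 1\<close> matrix
  \<open>s\<^sup>r\<close> suffices. Placing the blocks for all \<open>1 \<le> i \<le> j \<le> n\<close> on a diagonal gives size
  \<open>n + 2 (n choose 2) = n\<^sup>2\<close>, and injectivity of the powers of \<open>s\<close> recovers every run.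
\<close>

section \<open>Run lengths as invariants of sylvester classes\<close>

text \<open>
  Counting stops at a letter \<open>b\<close> with \<open>i \<le> b < j\<close> because neighbouring letters \<open>i\<close> and \<open>j\<close> to the
  left of \<open>b\<close> are inserted into different subtrees of its vertex, or of one above it, so that
  exchanging them does not change the tree: \<open>b\<close> separates them. The case \<open>i = j\<close> is meaningful:
  nothing separates, and the run is the number of occurrences of \<open>j\<close>. So the runs include the
  content of the word.
\<close>

definition run :: "nat \<Rightarrow> nat \<Rightarrow> nat list \<Rightarrow> nat" where
  "run i j u = count_list (takeWhile (\<lambda>a. a \<notin> {i..<j}) (rev u)) j"

definition separated :: "nat \<Rightarrow> nat \<Rightarrow> nat list \<Rightarrow> bool" where
  "separated i j u \<longleftrightarrow> set u \<inter> {i..<j} \<noteq> {}"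

lemma run_append:
  "run i j (u @ v) = (if separated i j v then run i j v else run i j u + run i j v)"
proof (cases "separated i j v")
  case True
  then obtain a where "a \<in> set (rev v)" "a \<in> {i..<j}"
    unfolding separated_def set_rev by blast
  then show ?thesis
    using True by (simp add: run_def takeWhile_append1)
next
  case False
  then have none: "\<And>a. a \<in> set (rev v) \<Longrightarrow> a \<notin> {i..<j}"
    by (auto simp: separated_def)
  have "takeWhile (\<lambda>a. a \<notin> {i..<j}) (rev v) = rev v"
    using none unfolding takeWhile_eq_all_conv by blast
  moreover have "takeWhile (\<lambda>a. a \<notin> {i..<j}) (rev v @ rev u)
      = rev v @ takeWhile (\<lambda>a. a \<notin> {i..<j}) (rev u)"
    using none by (rule takeWhile_append2)
  ultimately show ?thesis
    using False by (simp only: run_def rev_append count_list_append if_False add.commute)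
qed

lemma separated_append: "separated i j (u @ v) \<longleftrightarrow> separated i j u \<or> separated i j v"
  by (auto simp: separated_def)

lemma run_Nil [simp]: "run i j [] = 0"
  by (simp add: run_def)

lemma run_snoc:
  "run i j (u @ [x]) = (if x \<in> {i..<j} then 0 else run i j u + (if x = j then 1 else 0))"
  unfolding run_append by (auto simp: separated_def run_def)

lemma run_notin: "j \<notin> set u \<Longrightarrow> run i j u = 0"
  by (induction u rule: rev_induct) (auto simp: run_snoc)

lemma run_filter_le: "j \<le> x \<Longrightarrow> run i j (filter (\<lambda>b. b \<le> x) u) = run i j u"
  by (induction u rule: rev_induct) (auto simp: run_snoc)

text \<open>
  Deleting the letters \<open>\<le> x\<close> removes those separating letters that lie in \<open>{i..x}\<close>, so the lower
  end of the separating interval moves up to \<open>x + 1\<close>. This is how the right subtree is described by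
  runs of the whole word.
\<close>

lemma run_filter_gt:
  "x < j \<Longrightarrow> run i j (filter (\<lambda>b. b > x) u) = run (max i (Suc x)) j u"
  by (induction u rule: rev_induct) (auto simp: run_snoc)

lemma P_sylv_Nil [simp]: "P_sylv [] = Leaf"
  by (simp add: P_sylv_def)

lemma P_sylv_snoc:
  "P_sylv (u @ [x]) = Node (P_sylv (filter (\<lambda>b. b \<le> x) u)) x (P_sylv (filter (\<lambda>b. b > x) u))"
  by (simp add: P_sylv_def foldr_insert_Node)

text \<open>
  If \<open>x < y\<close>, then \<open>run x y\<close> is zero on a word ending in \<open>x\<close>, which is already separating, and
  positive on a word ending in \<open>y\<close>.
\<close>

lemma last_letter_from_runs:
  assumes runs: "\<And>i j. i \<le> j \<Longrightarrow> run i j (u @ [x]) = run i j (v @ [y])"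
  shows "x = y"
proof (rule ccontr)
  assume "x \<noteq> y"
  then consider "x < y" | "y < x" by linarith
  then show False
    using runs[of x y] runs[of y x] by cases (auto simp: run_snoc)
qed

text \<open>
  A run of \<open>u @ [x]\<close> depends on one side of \<open>x\<close> only: it is zero if \<open>x\<close> separates, it concerns
  letters above \<open>x\<close> if \<open>x < i\<close>, and letters up to \<open>x\<close> if \<open>j \<le> x\<close>. Conversely the runs of the two
  subwords are runs of \<open>u @ [x]\<close>, up to the contribution of a final letter \<open>x = j\<close>, or are zero
  because \<open>j\<close> lies on the wrong side of \<open>x\<close>.
\<close>

lemma runs_snoc_iff:
  "(\<forall>i j. i \<le> j \<longrightarrow> run i j (u @ [x]) = run i j (v @ [x])) \<longleftrightarrow>
   (\<forall>i j. i \<le> j \<longrightarrow> run i j (filter (\<lambda>b. b \<le> x) u) = run i j (filter (\<lambda>b. b \<le> x) v)) \<and>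
   (\<forall>i j. i \<le> j \<longrightarrow> run i j (filter (\<lambda>b. b > x) u) = run i j (filter (\<lambda>b. b > x) v))"
  (is "?A \<longleftrightarrow> ?L \<and> ?G")
proof (intro iffI conjI allI impI)
  fix i j :: nat
  assume A: ?A and ij: "i \<le> j"
  show "run i j (filter (\<lambda>b. b \<le> x) u) = run i j (filter (\<lambda>b. b \<le> x) v)"
  proof (cases "j \<le> x")
    case True
    then show ?thesis
      using A[rule_format, OF ij] by (simp add: run_filter_le run_snoc split: if_splits)
  next
    case False
    then show ?thesis by (simp add: run_notin)
  qed
  show "run i j (filter (\<lambda>b. b > x) u) = run i j (filter (\<lambda>b. b > x) v)"
  proof (cases "x < j")
    case True
    then have "run (max i (Suc x)) j (u @ [x]) = run (max i (Suc x)) j (v @ [x])"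
      using A ij by simp
    then show ?thesis
      using True by (simp add: run_filter_gt run_snoc)
  next
    case False
    then show ?thesis by (simp add: run_notin)
  qed
next
  fix i j :: nat
  assume LG: "?L \<and> ?G" and ij: "i \<le> j"
  consider "x < i" | "x \<in> {i..<j}" | "j \<le> x" by fastforce
  then show "run i j (u @ [x]) = run i j (v @ [x])"
  proof cases
    case 1
    then have "max i (Suc x) = i" "x < j" using ij by auto
    then show ?thesis
      using LG ij run_filter_gt[of x j i u] run_filter_gt[of x j i v] by (simp add: run_snoc)
  next
    case 2
    then show ?thesis by (simp add: run_snoc)
  next
    case 3
    then show ?thesis
      using LG ij run_filter_le[of j x i u] run_filter_le[of j x i v] by (simp add: run_snoc)
  qed
qed

text \<open>
  Both sides of the equivalence decompose along the last letter in the same way, so it follows by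
  induction on the length.
\<close>

theorem P_sylv_eq_iff_runs:
  "P_sylv u = P_sylv v \<longleftrightarrow> (\<forall>i j. i \<le> j \<longrightarrow> run i j u = run i j v)"
proof (induction "length u" arbitrary: u v rule: less_induct)
  case less
  show ?case
  proof (cases u rule: rev_cases; cases v rule: rev_cases)
    assume "u = []" "v = []"
    then show ?thesis by simp
  next
    fix v' y assume "u = []" "v = v' @ [y]"
    moreover have "run y y [] \<noteq> run y y (v' @ [y])" by (simp add: run_snoc)
    ultimately show ?thesis
      by (metis P_sylv_Nil P_sylv_snoc order_refl tree.distinct(1))
  next
    fix u' x assume "u = u' @ [x]" "v = []"
    moreover have "run x x (u' @ [x]) \<noteq> run x x []" by (simp add: run_snoc)
    ultimately show ?thesis
      by (metis P_sylv_Nil P_sylv_snoc order_refl tree.distinct(1))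
  next
    fix u' x v' y assume u: "u = u' @ [x]" and v: "v = v' @ [y]"
    have shorter: "length (filter p u') < length u" for p
      using length_filter_le[of p u'] u by (simp add: less_Suc_eq_le)
    show ?thesis
    proof (cases "x = y")
      case True
      show ?thesis
        unfolding u v True[symmetric] P_sylv_snoc runs_snoc_iff
        by (simp add: less[OF shorter])
    next
      case False
      then show ?thesis
        using last_letter_from_runs[of u' x v' y] unfolding u v P_sylv_snoc by auto
    qed
  qed
qed

text \<open>
  On words over \<open>{1..n}\<close> the runs with \<open>j\<close> outside the alphabet vanish, and \<open>i = 0\<close> gives the same
  run as \<open>i = 1\<close>. So finitely many runs, one per block of the representation, suffice.
\<close>

lemma P_sylv_eq_iff_runs_bounded:
  assumes "u \<in> lists {1..n}" "v \<in> lists {1..n}"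
  shows "P_sylv u = P_sylv v \<longleftrightarrow> (\<forall>i j. 1 \<le> i \<and> i \<le> j \<and> j \<le> n \<longrightarrow> run i j u = run i j v)"
    (is "_ \<longleftrightarrow> ?B")
proof -
  have zero: "run 0 j w = run 1 j w" if "w \<in> lists {1..n}" "0 < j" for j w
  proof -
    have "filter (\<lambda>b. b > 0) w = w" using that(1) by (auto intro!: filter_True)
    then show ?thesis using run_filter_gt[OF that(2), of 0 w] by simp
  qed
  have "run i j u = run i j v" if B: ?B and ij: "i \<le> j" for i j
  proof (cases "1 \<le> j \<and> j \<le> n")
    case True
    then show ?thesis
      using B ij zero[OF assms(1), of j] zero[OF assms(2), of j] by (cases "i = 0") auto
  next
    case False
    then have "j \<notin> set u" "j \<notin> set v" using assms by auto
    then show ?thesis by (simp add: run_notin)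
  qed
  then show ?thesis unfolding P_sylv_eq_iff_runs by blast
qed

section \<open>Block-diagonal matrices\<close>

lemma diag_block_mat_carrier:
  assumes "\<And>k. k \<in> set ks \<Longrightarrow> F k \<in> carrier_mat (d k) (d k)"
  shows "diag_block_mat (map F ks) \<in> carrier_mat (sum_list (map d ks)) (sum_list (map d ks))"
proof -
  have "map dim_row (map F ks) = map d ks" "map dim_col (map F ks) = map d ks"
    using assms by auto
  then show ?thesis
    unfolding carrier_mat_def by (simp only: mem_Collect_eq dim_diag_block_mat simp_thms)
qed

lemma diag_block_mat_mult:
  fixes A B :: "'i \<Rightarrow> 'a::comm_semiring_1 mat"
  assumes "\<And>k. k \<in> set ks \<Longrightarrow> A k \<in> carrier_mat (d k) (d k)"
    and "\<And>k. k \<in> set ks \<Longrightarrow> B k \<in> carrier_mat (d k) (d k)"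
  shows "diag_block_mat (map A ks) * diag_block_mat (map B ks)
    = diag_block_mat (map (\<lambda>k. A k * B k) ks)"
  using assms
proof (induction ks)
  case Nil
  then show ?case by simp
next
  case (Cons k ks)
  define m where "m = sum_list (map d ks)"
  have A: "A k \<in> carrier_mat (d k) (d k)" "diag_block_mat (map A ks) \<in> carrier_mat m m"
    and B: "B k \<in> carrier_mat (d k) (d k)" "diag_block_mat (map B ks) \<in> carrier_mat m m"
    using Cons.prems by (auto simp: m_def intro: diag_block_mat_carrier)
  have AB: "diag_block_mat (map A ks) * diag_block_mat (map B ks)
      = diag_block_mat (map (\<lambda>k. A k * B k) ks)"
    using Cons by auto
  have prod: "A k * B k \<in> carrier_mat (d k) (d k)"
    "diag_block_mat (map A ks) * diag_block_mat (map B ks) \<in> carrier_mat m m"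
    using A B by auto
  have dims: "dim_row (A k) = d k" "dim_col (A k) = d k" "dim_row (B k) = d k" "dim_col (B k) = d k"
    "dim_row (diag_block_mat (map A ks)) = m" "dim_col (diag_block_mat (map A ks)) = m"
    "dim_row (diag_block_mat (map B ks)) = m" "dim_col (diag_block_mat (map B ks)) = m"
    using A B by auto
  have zero: "0\<^sub>m (d k) m \<in> carrier_mat (d k) m" "0\<^sub>m m (d k) \<in> carrier_mat m (d k)" by auto
  show ?case
    using A B prod zero
    by (simp add: Let_def dims AB[symmetric]
        mult_four_block_mat[OF A(1) zero A(2) B(1) zero B(2)])
qed

lemma diag_block_mat_inject:
  assumes "\<And>k. k \<in> set ks \<Longrightarrow> A k \<in> carrier_mat (d k) (d k)"
    and "\<And>k. k \<in> set ks \<Longrightarrow> B k \<in> carrier_mat (d k) (d k)"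
    and "diag_block_mat (map A ks) = diag_block_mat (map B ks)"
    and "k \<in> set ks"
  shows "A k = B k"
  using assms
proof (induction ks)
  case Nil
  then show ?case by simp
next
  case (Cons l ks)
  define m where "m = sum_list (map d ks)"
  have A: "A l \<in> carrier_mat (d l) (d l)" "diag_block_mat (map A ks) \<in> carrier_mat m m"
    and B: "B l \<in> carrier_mat (d l) (d l)" "diag_block_mat (map B ks) \<in> carrier_mat m m"
    using Cons.prems(1,2) by (auto simp: m_def intro: diag_block_mat_carrier)
  have entry: "diag_block_mat (map A (l # ks)) $$ (r, c) = diag_block_mat (map B (l # ks)) $$ (r, c)"
    for r c
    using Cons.prems(3) by simp
  have "A l = B l"
  proof (rule eq_matI)
    fix r c assume "r < dim_row (B l)" "c < dim_col (B l)"
    then show "A l $$ (r, c) = B l $$ (r, c)"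
      using entry[of r c] A B by (simp add: Let_def)
  qed (use A B in auto)
  moreover have "diag_block_mat (map A ks) = diag_block_mat (map B ks)"
  proof (rule eq_matI)
    fix r c
    assume "r < dim_row (diag_block_mat (map B ks))" "c < dim_col (diag_block_mat (map B ks))"
    then show "diag_block_mat (map A ks) $$ (r, c) = diag_block_mat (map B ks) $$ (r, c)"
      using entry[of "d l + r" "d l + c"] A B by (simp add: Let_def)
  qed (use A B in auto)
  ultimately show ?case
    using Cons by auto
qed

lemma diag_block_mat_upper_triangular:
  assumes "\<And>k. k \<in> set ks \<Longrightarrow> A k \<in> carrier_mat (d k) (d k)"
    and "\<And>k. k \<in> set ks \<Longrightarrow> upper_triangular (A k)"
  shows "upper_triangular (diag_block_mat (map A ks))"
  using assms
proof (induction ks)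
  case Nil
  then show ?case by simp
next
  case (Cons k ks)
  have A: "A k \<in> carrier_mat (d k) (d k)"
    "diag_block_mat (map A ks) \<in> carrier_mat (sum_list (map d ks)) (sum_list (map d ks))"
    using Cons.prems(1) by (auto intro: diag_block_mat_carrier)
  have ut: "upper_triangular (A k)" "upper_triangular (diag_block_mat (map A ks))"
    using Cons by auto
  have "dim_col (A k) = d k" "dim_row (diag_block_mat (map A ks)) = sum_list (map d ks)"
    using A by auto
  then show ?case
    using upper_triangular_four_block[OF A ut] by (simp add: Let_def)
qed

section \<open>The blocks\<close>

text \<open>
  For \<open>i < j\<close> this is \<open>D\<^sup>r\<close> or \<open>E D\<^sup>r\<close> with \<open>r = run i j u\<close>: the two matrices differ only in the row
  that holds \<open>s\<^sup>r\<close>. Giving the entries directly in terms of the word, and not as a product over its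
  letters, makes invariance and injectivity immediate.
\<close>

definition run_block :: "'a::comm_semiring_1 \<Rightarrow> nat \<Rightarrow> nat \<Rightarrow> nat list \<Rightarrow> 'a mat" where
  "run_block s i j u =
    (if i = j then mat 1 1 (\<lambda>_. s ^ run i j u)
     else mat 2 2 (\<lambda>(r, c).
       if c = 0 then (if r = 0 then 1 else 0)
       else if (r = 0) = separated i j u then s ^ run i j u else 0))"

fun block_size :: "nat \<times> nat \<Rightarrow> nat" where
  "block_size (i, j) = (if i = j then 1 else 2)"

lemma run_block_carrier:
  "run_block s i j u \<in> carrier_mat (block_size (i, j)) (block_size (i, j))"
  by (simp add: run_block_def)

lemma run_block_upper_triangular: "upper_triangular (run_block s i j u)"
  by (auto simp: run_block_def intro!: upper_triangularI)

lemma run_block_Nil: "run_block s i j [] = 1\<^sub>m (block_size (i, j))"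
  by (auto simp: run_block_def separated_def intro!: eq_matI)

lemma run_block_append:
  "run_block s i j (u @ v) = run_block s i j u * run_block s i j v"
proof (cases "i = j")
  case True
  then show ?thesis
    by (auto simp: run_block_def run_append separated_def scalar_prod_def power_add intro!: eq_matI)
next
  case False
  show ?thesis
  proof (rule eq_matI)
    fix r c
    assume "r < dim_row (run_block s i j u * run_block s i j v)"
      "c < dim_col (run_block s i j u * run_block s i j v)"
    then have "r < 2" "c < 2" using False by (auto simp: run_block_def)
    then have "r = 0 \<or> r = 1" "c = 0 \<or> c = 1" by auto
    then show "run_block s i j (u @ v) $$ (r, c) = (run_block s i j u * run_block s i j v) $$ (r, c)"
      using False
      by (auto simp: run_block_def run_append separated_append scalar_prod_def power_add
          numeral_2_eq_2)
  qed (use False in \<open>auto simp: run_block_def\<close>)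
qed

text \<open>
  In either position of \<open>s\<^sup>r\<close> the second column of a \<open>2 \<times> 2\<close> block sums to \<open>s\<^sup>r\<close>, so the run can be
  read off without knowing whether a separating letter occurs.
\<close>

lemma run_from_run_block:
  assumes "infinite_mult_order s" and "run_block s i j u = run_block s i j v"
  shows "run i j u = run i j v"
proof -
  have power: "s ^ run i j w =
      (if i = j then run_block s i j w $$ (0, 0)
       else run_block s i j w $$ (0, 1) + run_block s i j w $$ (1, 1))" for w
    by (auto simp: run_block_def)
  have "s ^ run i j u = s ^ run i j v"
    unfolding power assms(2) ..
  then show ?thesis
    using assms(1) by (auto simp: infinite_mult_order_def dest: injD)
qed

lemma set_tree_P_sylv: "set_tree (P_sylv u) = set u"
  by (induction u) (auto simp: P_sylv_def set_tree_bst_insert)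

lemma run_block_sylv_invariant:
  assumes "P_sylv u = P_sylv v" and "i \<le> j"
  shows "run_block s i j u = run_block s i j v"
proof -
  have "run i j u = run i j v" "set u = set v"
    using assms P_sylv_eq_iff_runs set_tree_P_sylv by metis+
  moreover from this have "separated i j u = separated i j v" by (simp add: separated_def)
  ultimately show ?thesis by (simp only: run_block_def)
qed

section \<open>The block sizes\<close>

definition letter_pairs :: "nat \<Rightarrow> (nat \<times> nat) list" where
  "letter_pairs n = concat (map (\<lambda>j. map (\<lambda>i. (i, j)) [1..<Suc j]) [1..<Suc n])"

lemma set_letter_pairs: "set (letter_pairs n) = {(i, j). 1 \<le> i \<and> i \<le> j \<and> j \<le> n}"
  by (fastforce simp: letter_pairs_def simp del: upt_Suc)

text \<open>
  The pairs with a fixed larger letter \<open>j\<close> contribute \<open>2 (j - 1) + 1\<close>, and the first \<open>n\<close> odd numbers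
  sum to \<open>n\<^sup>2\<close>.
\<close>

lemma sum_block_sizes: "sum_list (map block_size (letter_pairs n)) = n\<^sup>2"
proof (induction n)
  case 0
  then show ?case by (simp add: letter_pairs_def)
next
  case (Suc n)
  have "map (\<lambda>i. block_size (i, Suc n)) [1..<Suc n] = map (\<lambda>_. 2) [1..<Suc n]"
    by (rule map_cong) auto
  then have "sum_list (map (\<lambda>i. block_size (i, Suc n)) [1..<Suc n]) = 2 * n"
    by (simp only: sum_list_triv length_upt) simp
  moreover have "[1..<Suc (Suc n)] = [1..<Suc n] @ [Suc n]" by simp
  ultimately have "sum_list (map (\<lambda>i. block_size (i, Suc n)) [1..<Suc (Suc n)]) = 2 * n + 1"
    by (simp only: map_append sum_list_append) simp
  moreover have "letter_pairs (Suc n) =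
      letter_pairs n @ map (\<lambda>i. (i, Suc n)) [1..<Suc (Suc n)]"
    by (simp add: letter_pairs_def)
  ultimately show ?case
    using Suc by (simp add: comp_def power2_eq_square del: upt_Suc block_size.simps)
qed

lemma Max_block_sizes:
  assumes "n \<ge> 1"
  shows "Max (set (map block_size (letter_pairs n))) = (if n = 1 then 1 else 2)"
proof (cases "n = 1")
  case True
  then show ?thesis by (simp add: letter_pairs_def)
next
  case False
  have "(1, 2) \<in> set (letter_pairs n)"
    using assms False by (simp add: set_letter_pairs)
  then have "block_size (1, 2) \<in> set (map block_size (letter_pairs n))"
    unfolding set_map by (rule imageI)
  then have "2 \<in> set (map block_size (letter_pairs n))" by simp
  then have "Max (set (map block_size (letter_pairs n))) = 2"
    by (intro Max_eqI) (auto split: if_splits)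
  then show ?thesis using False by simp
qed

section \<open>The representation\<close>

definition word_rep :: "'a::comm_semiring_1 \<Rightarrow> nat \<Rightarrow> nat list \<Rightarrow> 'a mat" where
  "word_rep s n u = diag_block_mat (map (\<lambda>p. run_block s (fst p) (snd p) u) (letter_pairs n))"

lemma run_block_pair_carrier:
  "run_block s (fst p) (snd p) u \<in> carrier_mat (block_size p) (block_size p)"
  using run_block_carrier[of s "fst p" "snd p" u] by simp

lemma word_rep_carrier: "word_rep s n u \<in> carrier (UT TYPE('a::comm_semiring_1) (n\<^sup>2))"
  for s :: "'a::comm_semiring_1"
proof -
  have "word_rep s n u \<in> carrier_mat (n\<^sup>2) (n\<^sup>2)"
    using diag_block_mat_carrier[of "letter_pairs n" _ block_size, OF run_block_pair_carrier]
    by (simp add: word_rep_def sum_block_sizes)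
  moreover have "upper_triangular (word_rep s n u)"
    unfolding word_rep_def
    by (intro diag_block_mat_upper_triangular[where d = block_size]
        run_block_pair_carrier run_block_upper_triangular)
  ultimately show ?thesis by (simp add: UT_def)
qed

lemma word_rep_append: "word_rep s n (u @ v) = word_rep s n u * word_rep s n v"
  using diag_block_mat_mult[of "letter_pairs n" "\<lambda>p. run_block s (fst p) (snd p) u" block_size
      "\<lambda>p. run_block s (fst p) (snd p) v", OF run_block_pair_carrier run_block_pair_carrier]
  by (simp add: word_rep_def run_block_append)

lemma word_rep_Nil: "word_rep s n [] = 1\<^sub>m (n\<^sup>2)"
proof -
  let ?Bs = "map (\<lambda>p. 1\<^sub>m (block_size p)) (letter_pairs n) :: 'a mat list"
  have "word_rep s n [] = diag_block_mat (map (\<lambda>A. 1\<^sub>m (dim_row A)) ?Bs)"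
    by (simp add: word_rep_def run_block_Nil comp_def)
  also have "\<dots> = 1\<^sub>m (sum_list (map dim_row ?Bs))"
    by (rule diag_block_one_mat)
  also have "\<dots> = 1\<^sub>m (n\<^sup>2)"
    by (simp add: comp_def sum_block_sizes)
  finally show ?thesis .
qed

lemma word_rep_block_diagonal: "block_diagonal (map block_size (letter_pairs n)) (word_rep s n u)"
  unfolding block_diagonal_def word_rep_def
  by (intro exI conjI refl) (auto simp: list_all2_conv_all_nth run_block_pair_carrier)

lemma word_rep_eq_iff:
  assumes "infinite_mult_order s" and "u \<in> lists {1..n}" and "v \<in> lists {1..n}"
  shows "word_rep s n u = word_rep s n v \<longleftrightarrow> P_sylv u = P_sylv v"
proof
  assume eq: "word_rep s n u = word_rep s n v"
  have "run i j u = run i j v" if "1 \<le> i \<and> i \<le> j \<and> j \<le> n" for i j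
  proof (rule run_from_run_block[OF assms(1)])
    have "(i, j) \<in> set (letter_pairs n)"
      using that by (simp add: set_letter_pairs)
    from diag_block_mat_inject[of "letter_pairs n" "\<lambda>p. run_block s (fst p) (snd p) u" block_size
        "\<lambda>p. run_block s (fst p) (snd p) v", OF run_block_pair_carrier run_block_pair_carrier _ this]
    show "run_block s i j u = run_block s i j v"
      using eq by (simp add: word_rep_def)
  qed
  then show "P_sylv u = P_sylv v"
    using P_sylv_eq_iff_runs_bounded[OF assms(2,3)] by blast
next
  assume "P_sylv u = P_sylv v"
  then show "word_rep s n u = word_rep s n v"
    unfolding word_rep_def
    by (intro arg_cong[of _ _ diag_block_mat] map_cong refl run_block_sylv_invariant)
      (auto simp: set_letter_pairs)
qed

theorem theorem6p6:
  fixes n :: nat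
  assumes "\<exists>s::'a::comm_semiring_1. infinite_mult_order s"
    and "n \<ge> 1"
  shows "\<exists>\<phi> :: nat list set \<Rightarrow> 'a mat.
           \<phi> \<in> hom (sylv n) (UT TYPE('a) (n\<^sup>2)) \<and>
           \<phi> \<one>\<^bsub>sylv n\<^esub> = \<one>\<^bsub>UT TYPE('a) (n\<^sup>2)\<^esub> \<and>
           inj_on \<phi> (carrier (sylv n)) \<and>
           (\<exists>ds. (\<forall>d\<in>set ds. d \<ge> 1) \<and> sum_list ds = n\<^sup>2 \<and>
                 Max (set ds) = (if n = 1 then 1 else 2) \<and>
                 (\<forall>x\<in>carrier (sylv n). block_diagonal ds (\<phi> x)))"
proof -
  obtain s :: 'a where s: "infinite_mult_order s" using assms(1) by blast
  define \<phi> where "\<phi> X = word_rep s n (SOME u. u \<in> X)" for X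
  have class_rep: "\<exists>u\<in>lists {1..n}. X = sylv_rel n `` {u}" if "X \<in> carrier (sylv n)" for X
    using that by (auto simp: sylv_def elim!: quotientE)
  have \<phi>_class: "\<phi> (sylv_rel n `` {u}) = word_rep s n u" if u: "u \<in> lists {1..n}" for u
  proof -
    define v where "v = (SOME v. v \<in> sylv_rel n `` {u})"
    have "u \<in> sylv_rel n `` {u}" using u by (simp add: sylv_rel_def)
    then have "v \<in> sylv_rel n `` {u}" unfolding v_def by (rule someI)
    then have "v \<in> lists {1..n}" "P_sylv u = P_sylv v" by (auto simp: sylv_rel_def)
    then show ?thesis
      using word_rep_eq_iff[OF s u, of v] by (simp add: \<phi>_def v_def)
  qed
  have "\<phi> \<in> hom (sylv n) (UT TYPE('a) (n\<^sup>2))"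
  proof (rule homI)
    fix X assume "X \<in> carrier (sylv n)"
    show "\<phi> X \<in> carrier (UT TYPE('a) (n\<^sup>2))"
      unfolding \<phi>_def by (rule word_rep_carrier)
  next
    fix X Y assume "X \<in> carrier (sylv n)" "Y \<in> carrier (sylv n)"
    then obtain u v where u: "u \<in> lists {1..n}" "X = sylv_rel n `` {u}"
      and v: "v \<in> lists {1..n}" "Y = sylv_rel n `` {v}"
      using class_rep by meson
    have "u @ v \<in> lists {1..n}" using u v by auto
    then show "\<phi> (X \<otimes>\<^bsub>sylv n\<^esub> Y) = \<phi> X \<otimes>\<^bsub>UT TYPE('a) (n\<^sup>2)\<^esub> \<phi> Y"
      unfolding u(2) v(2) mult_sylv_classes[OF u(1) v(1)] \<phi>_class[OF u(1)] \<phi>_class[OF v(1)]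
      by (simp only: \<phi>_class word_rep_append) (simp add: UT_def)
  qed
  moreover have "\<phi> \<one>\<^bsub>sylv n\<^esub> = \<one>\<^bsub>UT TYPE('a) (n\<^sup>2)\<^esub>"
    using \<phi>_class[of "[]"] by (simp add: sylv_def UT_def word_rep_Nil)
  moreover have "inj_on \<phi> (carrier (sylv n))"
  proof (rule inj_onI)
    fix X Y assume "X \<in> carrier (sylv n)" "Y \<in> carrier (sylv n)" and eq: "\<phi> X = \<phi> Y"
    then obtain u v where u: "u \<in> lists {1..n}" "X = sylv_rel n `` {u}"
      and v: "v \<in> lists {1..n}" "Y = sylv_rel n `` {v}"
      using class_rep by meson
    have "P_sylv u = P_sylv v"
      using eq word_rep_eq_iff[OF s u(1) v(1)] unfolding u(2) v(2) by (simp only: \<phi>_class u v)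
    then have "(u, v) \<in> sylv_rel n" using u v by (simp add: sylv_rel_def)
    then show "X = Y"
      unfolding u(2) v(2) by (rule equiv_class_eq[OF equiv_sylv_rel])
  qed
  moreover have "\<forall>d\<in>set (map block_size (letter_pairs n)). d \<ge> 1"
    by auto
  moreover have "\<forall>x\<in>carrier (sylv n). block_diagonal (map block_size (letter_pairs n)) (\<phi> x)"
    unfolding \<phi>_def by (simp add: word_rep_block_diagonal)
  ultimately show ?thesis
    using sum_block_sizes[of n] Max_block_sizes[OF assms(2)] by blast
qed

end
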